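(* Let $n\ge 1$ and $L\ge 3$ be integers, and let $\mathcal{A}$ be an alphabet of $k$ letters partitioned into $L$ categories, category $i$ containing $k_i$ letters, so that $k=\sum_{i=1}^L k_i$. Call an $n$-letter word over $\mathcal{A}$ a non-password if for at least one category, no letter of that category occurs in the word. Then there exists a universal cycle for the set of $n$-letter non-passwords over $\mathcal{A}$.
   Context: For a set $\mathcal{C}$ of $n$-letter words over an alphabet, a universal cycle (U-cycle) for $\mathcal{C}$ is a cyclic sequence $x_1x_2\dots x_N$ with $N=|\mathcal{C}|$ such that the $N$ words $x_ix_{i+1}\dots x_{i+n-1}$ ($1\le i\le N$, indices taken modulo $N$) are exactly the words of $\mathcal{C}$, each occurring exactly once. *)

theory Defs
  imports Main "HOL-Library.Disjoint_Sets"
begin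

definition cyclic_window :: "'a list \<Rightarrow> nat \<Rightarrow> nat \<Rightarrow> 'a list" where
  "cyclic_window xs n i = map (\<lambda>j. xs ! ((i + j) mod length xs)) [0..<n]"

text \<open>
  The list \<open>xs\<close> is one linear reading of the cyclic sequence, with positions counted from 0.
  The sequence may be shorter than \<open>n\<close>; windows then wrap around more than once.
\<close>
definition universal_cycle :: "nat \<Rightarrow> 'a list set \<Rightarrow> 'a list \<Rightarrow> bool" where
  "universal_cycle n W xs \<longleftrightarrow>
     length xs = card W \<and> bij_betw (cyclic_window xs n) {..<length xs} W"

definition non_passwords :: "'a set \<Rightarrow> nat \<Rightarrow> (nat \<Rightarrow> 'a set) \<Rightarrow> nat \<Rightarrow> 'a list set" where
  "non_passwords A L cat n =
     {w. set w \<subseteq> A \<and> length w = n \<and> (\<exists>i\<in>{1..L}. set w \<inter> cat i = {})}"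

end

theory Submission
  imports Defs "Graph_Theory.Euler"
begin

text \<open>
  Regard each word as an arc from its prefix to its suffix of length \<open>n - 1\<close>. If the set of words
  is closed under rotation then this digraph is balanced, so as soon as it is connected it has a
  closed Euler trail, and the first letters of the arcs along the trail form a universal cycle.
  For non-passwords, a prefix \<open>u\<close> missing category \<open>i\<close> can be walked to a prefix \<open>v\<close> missing
  category \<open>j\<close> through a constant word over a third category, the first half of the walk avoiding
  category \<open>i\<close> and the second half avoiding \<open>j\<close>.
\<close>

section \<open>Words as arcs: rotation gives well-formedness and balance\<close>

text \<open>Taking only suffixes as vertices leaves no isolated vertex. Once \<open>W\<close> is
  closed under rotation, the prefixes of its words are the same set.\<close>

definition overlap_digraph :: "'a list set \<Rightarrow> ('a list, 'a list) pre_digraph" where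
  "overlap_digraph W = \<lparr>verts = tl ` W, arcs = W, tail = butlast, head = tl\<rparr>"

lemma overlap_digraph_sel [simp]:
  "verts (overlap_digraph W) = tl ` W"
  "arcs (overlap_digraph W) = W"
  "tail (overlap_digraph W) = butlast"
  "head (overlap_digraph W) = tl"
  by (simp_all add: overlap_digraph_def)

lemma butlast_rotate1: "butlast (rotate1 w) = tl w"
  by (cases w) simp_all

lemma ex_rotate1:
  obtains v where "w = rotate1 v"
  using surjD[OF surj_rotate1] by blast

text \<open>The point is that tails are vertices: if \<open>w = rotate1 v\<close>, then
  \<open>butlast w = tl v\<close> with \<open>v\<close> in \<open>W\<close>.\<close>

lemma fin_digraph_overlap_digraph:
  assumes "finite W" and "\<And>w. rotate1 w \<in> W \<longleftrightarrow> w \<in> W"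
  shows "fin_digraph (overlap_digraph W)"
proof
  fix w assume "w \<in> arcs (overlap_digraph W)"
  moreover obtain v where "w = rotate1 v"
    by (rule ex_rotate1)
  ultimately show "tail (overlap_digraph W) w \<in> verts (overlap_digraph W)"
    using assms(2) by (auto simp: butlast_rotate1)
qed (use assms(1) in auto)

text \<open>Since \<open>butlast (rotate1 w) = tl w\<close>, rotation is a bijection from the arcs
  entering \<open>u\<close> to the arcs leaving it.\<close>

lemma in_degree_overlap_digraph:
  assumes "\<And>w. rotate1 w \<in> W \<longleftrightarrow> w \<in> W"
  shows "in_degree (overlap_digraph W) u = out_degree (overlap_digraph W) u"
proof -
  have image: "rotate1 ` {w \<in> W. tl w = u} = {w \<in> W. butlast w = u}"
  proof (intro equalityI subsetI)
    fix w assume w: "w \<in> {w \<in> W. butlast w = u}"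
    obtain v where "w = rotate1 v"
      by (rule ex_rotate1)
    with w assms show "w \<in> rotate1 ` {w \<in> W. tl w = u}"
      by (auto simp: butlast_rotate1)
  qed (auto simp: assms butlast_rotate1)
  have inj: "inj_on rotate1 {w \<in> W. tl w = u}"
    using inj_rotate1 by (rule inj_on_subset) simp
  show ?thesis
    using card_image[OF inj] unfolding image
    by (simp add: in_degree_def out_degree_def in_arcs_def out_arcs_def)
qed

section \<open>From closed trails to cyclic sequences\<close>

lemma (in pre_digraph) cas_nth:
  "cas u p v \<Longrightarrow> Suc i < length p \<Longrightarrow> head G (p ! i) = tail G (p ! Suc i)"
proof (induction p arbitrary: u i)
  case (Cons e p)
  then show ?case
    by (cases i; cases p) auto
qed simp

lemma (in pre_digraph) cas_head_last:
  "cas u p v \<Longrightarrow> p \<noteq> [] \<Longrightarrow> head G (last p) = v"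
  by (induction p arbitrary: u) auto

text \<open>At the wrap-around, the last arc ends in \<open>u\<close>, which is also where arc 0
  starts.\<close>

lemma (in pre_digraph) cas_closed_nth:
  assumes "cas u p u" and "i < length p"
  shows "head G (p ! i) = tail G (p ! (Suc i mod length p))"
proof (cases "Suc i < length p")
  case True
  then show ?thesis
    using cas_nth assms by simp
next
  case False
  then have i: "Suc i = length p" and p: "p \<noteq> []"
    using assms(2) by auto
  then have "p ! i = last p"
    by (metis diff_Suc_1 last_conv_nth)
  moreover have "tail G (p ! 0) = u"
    using assms(1) p by (cases p) auto
  ultimately show ?thesis
    using cas_head_last assms(1) p i by simp
qed

lemma cyclic_window_map_hd:
  assumes len: "\<And>w. w \<in> set p \<Longrightarrow> length w = n" and "i < length p"
    and step: "\<And>i. i < length p \<Longrightarrow> tl (p ! i) = butlast (p ! (Suc i mod length p))"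
  shows "cyclic_window (map hd p) n i = p ! i"
proof -
  have pos: "0 < length p"
    using assms(2) by linarith
  \<comment> \<open>Letter \<open>j + 1\<close> of a word is letter \<open>j\<close> of its
    \<open>tl\<close>, hence letter \<open>j\<close> of the next word. As the induction is over
    \<open>j\<close> for all \<open>i\<close> with cyclic indices, \<open>n\<close> may exceed
    \<open>length p\<close>.\<close>
  have nth: "p ! i ! j = hd (p ! ((i + j) mod length p))" if "i < length p" "j < n" for i j
    using that
  proof (induction j arbitrary: i)
    case 0
    then have "p ! i \<noteq> []"
      using len nth_mem by fastforce
    with 0 show ?case
      by (simp add: hd_conv_nth)
  next
    case (Suc j)
    let ?i = "Suc i mod length p"
    have i: "?i < length p"
      using pos by simp
    have "p ! i ! Suc j = tl (p ! i) ! j"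
      using Suc.prems len by (simp add: nth_tl)
    also have "\<dots> = butlast (p ! ?i) ! j"
      using step Suc.prems by simp
    also have "\<dots> = p ! ?i ! j"
      using Suc.prems len[OF nth_mem[OF i]] by (simp add: nth_butlast)
    also have "\<dots> = hd (p ! ((?i + j) mod length p))"
      using Suc i by simp
    also have "(?i + j) mod length p = (i + Suc j) mod length p"
      by (simp add: mod_add_left_eq)
    finally show ?case .
  qed
  show ?thesis
  proof (rule nth_equalityI)
    show "length (cyclic_window (map hd p) n i) = length (p ! i)"
      using len assms(2) by (simp add: cyclic_window_def)
  next
    fix j assume "j < length (cyclic_window (map hd p) n i)"
    then show "cyclic_window (map hd p) n i ! j = p ! i ! j"
      using nth assms(2) pos by (simp add: cyclic_window_def)
  qed
qed

theorem universal_cycle_if_connected: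
  assumes "finite W" and len: "\<And>w. w \<in> W \<Longrightarrow> length w = n"
    and rot: "\<And>w. rotate1 w \<in> W \<longleftrightarrow> w \<in> W"
    and con: "connected (overlap_digraph W)"
  shows "\<exists>xs. universal_cycle n W xs"
proof -
  let ?G = "overlap_digraph W"
  interpret fin_digraph ?G
    using assms(1) rot by (rule fin_digraph_overlap_digraph)
  obtain u p where "euler_trail u p u"
    using closed_euler1[OF con in_degree_overlap_digraph[OF rot]] by blast
  then have p: "cas u p u" "distinct p" "set p = W"
    by (simp_all add: euler_trail_def trail_def awalk_def)
  \<comment> \<open>The windows are thus the arcs of the trail, so it remains that \<open>p\<close>
    lists \<open>W\<close> without repetition, which an Euler trail does.\<close>
  have "cyclic_window (map hd p) n i = p ! i" if "i < length p" for i
    using len p(3) that cas_closed_nth[OF p(1), simplified] by (intro cyclic_window_map_hd) simp_all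
  then have "bij_betw (cyclic_window (map hd p) n) {..<length p} W \<longleftrightarrow>
      bij_betw ((!) p) {..<length p} W"
    by (intro bij_betw_cong) (simp only: lessThan_iff)
  moreover have "bij_betw ((!) p) {..<length p} W"
    using p by (intro bij_betw_nth) simp_all
  moreover have "length p = card W"
    using p distinct_card[of p] by simp
  ultimately have "universal_cycle n W (map hd p)"
    by (simp add: universal_cycle_def)
  then show ?thesis ..
qed

section \<open>Connectivity for non-passwords\<close>

text \<open>Shift the letters of \<open>v\<close> in from the right one by one; every word met on
  the way is over \<open>B\<close>, hence an arc. Below, \<open>B\<close> is
  \<open>A - cat i\<close>.\<close>

lemma reachable_overlap_digraph:
  assumes wf: "wf_digraph (overlap_digraph W)"
    and W: "\<And>w. set w \<subseteq> B \<Longrightarrow> length w = Suc m \<Longrightarrow> w \<in> W"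
    and u: "set u \<subseteq> B" "length u = m" and v: "set v \<subseteq> B" "length v = m"
    and vert: "u \<in> tl ` W"
  shows "u \<rightarrow>\<^sup>*\<^bsub>overlap_digraph W\<^esub> v"
proof -
  interpret wf_digraph "overlap_digraph W"
    by (rule wf)
  have "u \<rightarrow>\<^sup>*\<^bsub>overlap_digraph W\<^esub> (drop k u @ take k v)" if "k \<le> m" for k
    using that
  proof (induction k)
    case 0
    then show ?case
      using vert by simp
  next
    case (Suc k)
    \<comment> \<open>The arc from the \<open>k\<close>-th intermediate vertex to the next: the two
      overlap in all but the outer letters of \<open>?w\<close>.\<close>
    let ?w = "drop k u @ take (Suc k) v"
    have "set ?w \<subseteq> B"
      using u(1) v(1) set_drop_subset[of k u] set_take_subset[of "Suc k" v] by auto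
    then have "?w \<in> W"
      using Suc.prems u v by (intro W) auto
    moreover have "butlast ?w = drop k u @ take k v"
      using Suc.prems v by (simp add: butlast_append take_Suc_conv_app_nth)
    moreover have "tl ?w = drop (Suc k) u @ take (Suc k) v"
      using Suc.prems u by (simp add: drop_Suc tl_drop)
    ultimately have "(drop k u @ take k v) \<rightarrow>\<^bsub>overlap_digraph W\<^esub> (drop (Suc k) u @ take (Suc k) v)"
      unfolding arcs_ends_conv by (intro rev_image_eqI[of ?w]) simp_all
    with Suc.IH Suc.prems show ?case
      by (meson Suc_leD reachable_adj_trans)
  qed
  from this[of m] show ?thesis
    using u v by simp
qed

lemma in_non_passwords_iff:
  "w \<in> non_passwords A L cat n \<longleftrightarrow> length w = n \<and> (\<exists>i\<in>{1..L}. set w \<subseteq> A - cat i)"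
  by (simp add: non_passwords_def Diff_eq disjoint_eq_subset_Compl) blast

lemma rotate1_in_non_passwords:
  "rotate1 w \<in> non_passwords A L cat n \<longleftrightarrow> w \<in> non_passwords A L cat n"
  by (simp add: non_passwords_def)

lemma finite_non_passwords:
  assumes "finite A"
  shows "finite (non_passwords A L cat n)"
  by (rule finite_subset[OF _ finite_lists_length_eq[OF assms, of n]]) (auto simp: non_passwords_def)

lemma strongly_connected_non_passwords:
  fixes A :: "'a set"
  assumes "n \<ge> 1" and "L \<ge> 3" and "finite A"
    and part: "partition_on A (cat ` {1..L})" and inj: "inj_on cat {1..L}"
  shows "strongly_connected (overlap_digraph (non_passwords A L cat n))"
proof -
  let ?W = "non_passwords A L cat n"
  let ?G = "overlap_digraph ?W"
  obtain m where n: "n = Suc m"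
    using assms(1) by (cases n) auto
  interpret fin_digraph ?G
    by (rule fin_digraph_overlap_digraph)
      (simp_all add: finite_non_passwords assms(3) rotate1_in_non_passwords)
  \<comment> \<open>The case \<open>i = j\<close> is included; it supplies a letter outside a single
    category.\<close>
  have third: "\<exists>c \<in> A. c \<notin> cat i \<and> c \<notin> cat j" if "i \<in> {1..L}" "j \<in> {1..L}" for i j
  proof -
    have "card {i, j} < card {1..L}"
      using assms(2) card_insert_le_m1[of 2 "{j}" i] by simp
    then obtain l where l: "l \<in> {1..L}" "l \<noteq> i" "l \<noteq> j"
      by (metis card_mono finite.emptyI finite.insertI insertCI linorder_not_le subsetI)
    then have "cat l \<noteq> {}"
      using part by (auto simp: partition_on_def)
    then obtain c where c: "c \<in> cat l"
      by blast
    \<comment> \<open>Injectivity of \<open>cat\<close> turns distinct indices into distinct blocks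
      of the partition, which are disjoint.\<close>
    have "disjnt (cat l) (cat i')" if "i' \<in> {1..L}" "l \<noteq> i'" for i'
      using part inj l(1) that
      by (auto simp: partition_on_def dest!: disjointD[of _ "cat l" "cat i'"] dest: inj_onD simp: disjnt_def)
    moreover have "c \<in> A"
      using part c l(1) by (auto simp: partition_on_def)
    ultimately show ?thesis
      using c l that by (auto simp: disjnt_iff)
  qed
  have W: "w \<in> ?W" if "i \<in> {1..L}" "set w \<subseteq> A - cat i" "length w = Suc m" for w i
    using that n by (auto simp only: in_non_passwords_iff)
  have vert: "u \<in> tl ` ?W \<longleftrightarrow> length u = m \<and> (\<exists>i\<in>{1..L}. set u \<subseteq> A - cat i)" for u
  proof
    assume "u \<in> tl ` ?W"
    then obtain w i where "u = tl w" "length w = n" "i \<in> {1..L}" "set w \<subseteq> A - cat i"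
      by (elim imageE) (use in_non_passwords_iff[of _ A L cat n] in blast)
    moreover from this n have "set u \<subseteq> set w"
      by (cases w) auto
    ultimately show "length u = m \<and> (\<exists>i\<in>{1..L}. set u \<subseteq> A - cat i)"
      using n by (metis diff_Suc_1 length_tl order_trans)
  next
    assume u: "length u = m \<and> (\<exists>i\<in>{1..L}. set u \<subseteq> A - cat i)"
    then obtain i where i: "i \<in> {1..L}" "set u \<subseteq> A - cat i"
      by blast
    \<comment> \<open>Prepending such a letter to \<open>u\<close> gives a word that still misses
      category \<open>i\<close>.\<close>
    moreover obtain c where "c \<in> A" "c \<notin> cat i"
      using third[of i i] i by blast
    ultimately have "c # u \<in> ?W"
      using u by (intro W) auto
    then show "u \<in> tl ` ?W"
      by force
  qed
  have "u \<rightarrow>\<^sup>*\<^bsub>?G\<^esub> v" if uv: "u \<in> tl ` ?W" "v \<in> tl ` ?W" for u v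
  proof -
    obtain i j where i: "i \<in> {1..L}" "set u \<subseteq> A - cat i" and j: "j \<in> {1..L}" "set v \<subseteq> A - cat j"
      and len: "length u = m" "length v = m"
      using uv unfolding vert by blast
    then obtain c where c: "c \<in> A" "c \<notin> cat i" "c \<notin> cat j"
      using third by blast
    \<comment> \<open>This word is over both \<open>A - cat i\<close> and \<open>A - cat j\<close>,
      so each leg of the walk stays within one sub-alphabet.\<close>
    let ?c = "replicate m c"
    have "u \<rightarrow>\<^sup>*\<^bsub>?G\<^esub> ?c"
      by (rule reachable_overlap_digraph[OF wf_digraph W[OF i(1)] i(2) len(1) _ _ uv(1)])
        (use c in auto)
    also have "?c \<rightarrow>\<^sup>*\<^bsub>?G\<^esub> v"
    proof (rule reachable_overlap_digraph[OF wf_digraph W[OF j(1)] _ _ j(2) len(2)])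
      show "?c \<in> tl ` ?W"
        using c j(1) unfolding vert by (intro conjI bexI[of _ j]) auto
    qed (use c in auto)
    finally show ?thesis .
  qed
  \<comment> \<open>Strong connectedness includes having a vertex; for \<open>n = 1\<close> it is
    the empty word.\<close>
  moreover have "tl ` ?W \<noteq> {}"
  proof -
    obtain c where "c \<in> A" "c \<notin> cat 1"
      using third[of 1 1] assms(2) by auto
    then have "replicate m c \<in> tl ` ?W"
      unfolding vert using assms(2) by (intro conjI bexI[of _ 1]) auto
    then show ?thesis
      by blast
  qed
  ultimately show ?thesis
    by (simp add: strongly_connected_def)
qed

theorem theorem8:
  fixes A :: "'a set" and cat :: "nat \<Rightarrow> 'a set" and k :: "nat \<Rightarrow> nat" and n L :: nat
  assumes "n \<ge> 1" and "L \<ge> 3"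
    and "finite A"
    and "partition_on A (cat ` {1..L})" and "inj_on cat {1..L}"
    and "\<And>i. i \<in> {1..L} \<Longrightarrow> card (cat i) = k i"
  shows "\<exists>xs. universal_cycle n (non_passwords A L cat n) xs"
proof (rule universal_cycle_if_connected)
  let ?W = "non_passwords A L cat n"
  show "finite ?W"
    using assms(3) by (rule finite_non_passwords)
  show "rotate1 w \<in> ?W \<longleftrightarrow> w \<in> ?W" for w
    by (rule rotate1_in_non_passwords)
  show "length w = n" if "w \<in> ?W" for w
    using that by (simp add: non_passwords_def)
  interpret fin_digraph "overlap_digraph ?W"
    by (rule fin_digraph_overlap_digraph)
      (simp_all add: finite_non_passwords assms(3) rotate1_in_non_passwords)
  have "strongly_connected (overlap_digraph ?W)"
    using assms(1-5) by (rule strongly_connected_non_passwords)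
  \<comment> \<open>Connectedness refers to the symmetric closure, in which directed reachability
    persists.\<close>
  then show "connected (overlap_digraph ?W)"
    unfolding strongly_connected_def
    by (blast intro: connectedI reachable_mk_symmetricI)
qed

end
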